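(* Let $B_n$ be a book graph. Then for a vertex $a'$ of $B_n$, $$d_d(a')=\begin{cases}2 & \text{if } a' \text{ is a center vertex},\\ n & \text{otherwise.}\end{cases}$$
   Context: A dominating set of a graph $G$ is a set $D\subseteq V(G)$ such that every vertex in $V(G)\setminus D$ is adjacent to some vertex of $D$. A minimal dominating set is a dominating set that does not properly contain any other dominating set. The domination degree of a vertex $a$ is $d_d(a)=\min\{|D| : D \text{ is a minimal dominating set of } G \text{ with } a\in D\}$. The book graph $B_n$ is the Cartesian product $S_{n+1}\times P_2$, where $S_{n+1}$ is the star with $n+1$ vertices (a vertex $a$ of degree $n$, adjacent to the $n$ remaining vertices $a_1,\dots,a_n$, with no other edges) and $P_2$ is the path on two vertices $b_1,b_2$; in the Cartesian product, $(u,v)$ and $(u',v')$ are adjacent iff either $u=u'$ and $v$ is adjacent to $v'$, or $v=v'$ and $u$ is adjacent to $u'$. The center vertices of $B_n$ are the two vertices $(a,b_1)$ and $(a,b_2)$.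
   Formalization: The book graph B_n is taken with n ≥ 2; the formula fails for n = 1 (B_1 is a 4-cycle, where non-center vertices have domination degree 2, not 1) and for n = 0 (B_0 is a single edge, where centers have degree 1). *)

theory Defs
  imports "Graph_Theory.Pair_Digraph"
begin

text \<open>
  Finite simple graphs are the library's \<^locale>\<open>pair_graph\<close>s: an edge $uv$ is represented by the
  two arcs $(u,v)$ and $(v,u)$.
\<close>

definition dominating_set :: "'a pair_pre_digraph \<Rightarrow> 'a set \<Rightarrow> bool" where
  "dominating_set G D \<longleftrightarrow>
     D \<subseteq> pverts G \<and> (\<forall>v \<in> pverts G - D. \<exists>u \<in> D. (v, u) \<in> parcs G)"

definition minimal_dominating_set :: "'a pair_pre_digraph \<Rightarrow> 'a set \<Rightarrow> bool" where
  "minimal_dominating_set G D \<longleftrightarrow>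
     dominating_set G D \<and> (\<forall>D'. D' \<subset> D \<longrightarrow> \<not> dominating_set G D')"

text \<open>
  Meaningful for a vertex of a finite graph only: there the set is finite, and it is nonempty because
  every maximal independent set is a minimal dominating set.
\<close>

definition domination_degree :: "'a pair_pre_digraph \<Rightarrow> 'a \<Rightarrow> nat" where
  "domination_degree G a = Min {card D | D. minimal_dominating_set G D \<and> a \<in> D}"

definition cartesian_product ::
  "'a pair_pre_digraph \<Rightarrow> 'b pair_pre_digraph \<Rightarrow> ('a \<times> 'b) pair_pre_digraph" where
  "cartesian_product G H =
     \<lparr> pverts = pverts G \<times> pverts H,
       parcs = {((u, v), (u', v')) | u v u' v'.
         (u, v) \<in> pverts G \<times> pverts H \<and> (u', v') \<in> pverts G \<times> pverts H \<and>
         (u = u' \<and> (v, v') \<in> parcs H \<or> v = v' \<and> (u, u') \<in> parcs G)} \<rparr>"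

text \<open>
  The star $S_m$ on $m$ vertices: $0$ is the vertex $a$ of degree $m - 1$, and $i \ge 1$ is the leaf $a_i$.
\<close>

definition star_graph :: "nat \<Rightarrow> nat pair_pre_digraph" where
  "star_graph m =
     \<lparr> pverts = {0..<m}, parcs = {(0, i) | i. i \<in> {1..<m}} \<union> {(i, 0) | i. i \<in> {1..<m}} \<rparr>"

text \<open>The path $P_m$ on $m$ vertices; $i$ is the vertex $b_i$.\<close>

definition path_graph :: "nat \<Rightarrow> nat pair_pre_digraph" where
  "path_graph m =
     \<lparr> pverts = {1..m},
       parcs = {(i, j) | i j. i \<in> {1..m} \<and> j \<in> {1..m} \<and> (j = i + 1 \<or> i = j + 1)} \<rparr>"

definition book_graph :: "nat \<Rightarrow> (nat \<times> nat) pair_pre_digraph" where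
  "book_graph n = cartesian_product (star_graph (n + 1)) (path_graph 2)"

definition book_centers :: "(nat \<times> nat) set" where
  "book_centers = {(0, 1), (0, 2)}"

lemma book_centers_subset: "book_centers \<subseteq> pverts (book_graph n)"
  by (auto simp: book_centers_def book_graph_def cartesian_product_def star_graph_def path_graph_def)

lemma pair_graph_book_graph: "pair_graph (book_graph n)"
proof
  show "finite (parcs (book_graph n))"
  proof (rule finite_subset)
    show "parcs (book_graph n) \<subseteq> pverts (book_graph n) \<times> pverts (book_graph n)"
      by (auto simp: book_graph_def cartesian_product_def)
  qed (auto simp: book_graph_def cartesian_product_def star_graph_def path_graph_def)
qed (auto simp: book_graph_def cartesian_product_def star_graph_def path_graph_def
       symmetric_def arcs_ends_def arc_to_ends_def intro!: symI)

end

theory Submission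
  imports Defs
begin

text \<open>
  Think of the book as \<open>n\<close> pages \<open>{(j, 1), (j, 2)}\<close> glued to the spine formed by the two centers.
  The centers together dominate the whole book. A dominating set that omits a center \<open>(0, c)\<close> must
  meet every page, because \<open>(j, c)\<close> can then be dominated only from its own page
  (\<open>dominating_set_meets_pages\<close>); such a set has at least \<open>n\<close> elements.

  The spine is therefore a minimal dominating set of size \<open>2\<close>, and as \<open>n \<ge> 2\<close> no dominating set is
  smaller. A minimal dominating set containing a page vertex cannot contain the spine, which
  would be a proper dominating subset; hence it omits a center and has at least \<open>n\<close> elements. The
  bound is attained by a transversal of the pages that uses both layers, so that both centers are
  dominated.
\<close>

lemma pverts_book_graph: "pverts (book_graph n) = {0..n} \<times> {1, 2}"
  by (auto simp: book_graph_def cartesian_product_def star_graph_def path_graph_def)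

lemma parcs_book_graph:
  "((i, b), (j, c)) \<in> parcs (book_graph n) \<longleftrightarrow>
     i \<le> n \<and> j \<le> n \<and> b \<in> {1, 2} \<and> c \<in> {1, 2} \<and>
     (i = j \<and> b \<noteq> c \<or> b = c \<and> (i = 0 \<longleftrightarrow> j \<noteq> 0))"
  by (auto simp: book_graph_def cartesian_product_def star_graph_def path_graph_def)

lemma domination_degree_eqI:
  assumes "finite (pverts G)" "minimal_dominating_set G D" "a \<in> D"
    and least: "\<And>D'. minimal_dominating_set G D' \<Longrightarrow> a \<in> D' \<Longrightarrow> card D \<le> card D'"
  shows "domination_degree G a = card D"
  unfolding domination_degree_def
proof (rule Min_eqI)
  have "{card D | D. minimal_dominating_set G D \<and> a \<in> D} \<subseteq> card ` Pow (pverts G)"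
    by (auto simp: minimal_dominating_set_def dominating_set_def)
  then show "finite {card D | D. minimal_dominating_set G D \<and> a \<in> D}"
    using assms(1) by (simp add: finite_subset)
qed (use assms in auto)

lemma finite_dominating_set_book_graph:
  "dominating_set (book_graph n) D \<Longrightarrow> finite D"
  by (rule finite_subset[of _ "pverts (book_graph n)"])
     (auto simp: dominating_set_def pverts_book_graph)

text \<open>If \<open>(0, c)\<close> is missing, the closed neighbourhood of \<open>(j, c)\<close> offers only vertices of page \<open>j\<close>.\<close>

lemma dominating_set_meets_pages:
  assumes dom: "dominating_set (book_graph n) D" and "\<not> book_centers \<subseteq> D"
  shows "{1..n} \<subseteq> fst ` D"
proof
  fix j assume j: "j \<in> {1..n}"
  obtain c :: nat where c: "c \<in> {1, 2}" "(0, c) \<notin> D"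
    using assms(2) by (auto simp: book_centers_def)
  show "j \<in> fst ` D"
  proof (cases "(j, c) \<in> D")
    case True
    then show ?thesis by force
  next
    case False
    with j c have "(j, c) \<in> pverts (book_graph n) - D"
      by (auto simp: pverts_book_graph)
    with dom obtain u where u: "u \<in> D" "((j, c), u) \<in> parcs (book_graph n)"
      unfolding dominating_set_def by blast
    obtain i b where ib: "u = (i, b)" by force
    have "i = j" using u c j by (auto simp: ib parcs_book_graph)
    with u(1) ib show ?thesis by force
  qed
qed

lemma card_dominating_set_missing_center:
  assumes "dominating_set (book_graph n) D" and "\<not> book_centers \<subseteq> D"
  shows "n \<le> card D"
  using card_mono[OF _ dominating_set_meets_pages[OF assms]]
    card_image_le[of D fst] finite_dominating_set_book_graph[OF assms(1)]
  by simp

lemma card_dominating_set_ge_2: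
  assumes "n \<ge> 2" and "dominating_set (book_graph n) D"
  shows "2 \<le> card D"
proof (cases "book_centers \<subseteq> D")
  case True
  have "card book_centers = 2" by (simp add: book_centers_def)
  then show ?thesis
    using card_mono[OF finite_dominating_set_book_graph[OF assms(2)] True] by simp
next
  case False
  then show ?thesis
    using card_dominating_set_missing_center[OF assms(2)] assms(1) by simp
qed

lemma dominating_set_book_centers: "dominating_set (book_graph n) book_centers"
  unfolding dominating_set_def
proof (intro conjI ballI)
  fix v assume v: "v \<in> pverts (book_graph n) - book_centers"
  obtain j c where vjc: "v = (j, c)" by force
  have "j \<noteq> 0" "j \<le> n" "c \<in> {1, 2}"
    using v by (auto simp: vjc pverts_book_graph book_centers_def)
  with vjc have "(0, c) \<in> book_centers" "(v, (0, c)) \<in> parcs (book_graph n)"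
    by (auto simp: parcs_book_graph book_centers_def)
  then show "\<exists>u\<in>book_centers. (v, u) \<in> parcs (book_graph n)" by blast
qed (rule book_centers_subset)

lemma minimal_dominating_set_book_centers:
  assumes "n \<ge> 1"
  shows "minimal_dominating_set (book_graph n) book_centers"
  unfolding minimal_dominating_set_def
proof (intro conjI allI impI notI)
  fix D assume "D \<subset> book_centers" "dominating_set (book_graph n) D"
  with dominating_set_meets_pages[of n D] have "{1..n} \<subseteq> fst ` book_centers"
    by blast
  moreover have "1 \<in> {1..n}" using assms by simp
  ultimately have "1 \<in> fst ` book_centers" by (rule subsetD)
  then show False by (simp add: book_centers_def)
qed (rule dominating_set_book_centers)

text \<open>
  The parameters make \<open>(i, b)\<close> an element, so that each page vertex lies in one of these sets. For
  \<open>b \<in> {1, 2}\<close> the other layer is \<open>3 - b\<close>.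
\<close>

definition page_transversal :: "nat \<Rightarrow> nat \<Rightarrow> nat \<Rightarrow> (nat \<times> nat) set" where
  "page_transversal n i b = (\<lambda>j. (j, if j = i then b else 3 - b)) ` {1..n}"

lemma card_page_transversal: "card (page_transversal n i b) = n"
  unfolding page_transversal_def by (subst card_image) (auto simp: inj_on_def)

lemma page_transversal_disjoint_centers: "page_transversal n i b \<inter> book_centers = {}"
  by (auto simp: page_transversal_def book_centers_def)

text \<open>
  Page \<open>i\<close> dominates the center \<open>(0, b)\<close>; the other center needs a second page, which is where
  \<open>n \<ge> 2\<close> enters.
\<close>

lemma dominating_set_page_transversal:
  assumes n: "n \<ge> 2" and i: "i \<in> {1..n}" and b: "b \<in> {1, 2}"
  shows "dominating_set (book_graph n) (page_transversal n i b)"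
  unfolding dominating_set_def
proof (intro conjI ballI)
  let ?layer = "\<lambda>j. if j = i then b else 3 - b"
  have in_T: "(j, ?layer j) \<in> page_transversal n i b" if "j \<in> {1..n}" for j
    unfolding page_transversal_def using that by (rule imageI)
  show "page_transversal n i b \<subseteq> pverts (book_graph n)"
  proof -
    have "?layer j \<in> {1, 2}" for j
      using b by (cases "j = i") auto
    then show ?thesis
      unfolding page_transversal_def pverts_book_graph by (intro image_subsetI SigmaI) simp_all
  qed
  fix v assume v: "v \<in> pverts (book_graph n) - page_transversal n i b"
  obtain j c where vjc: "v = (j, c)" by force
  have j: "j \<le> n" and c: "c \<in> {1, 2}" using v by (auto simp: vjc pverts_book_graph)
  show "\<exists>u\<in>page_transversal n i b. (v, u) \<in> parcs (book_graph n)"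
  proof (cases "j = 0")
    case True
    define k where "k = (if c = b then i else if i = 1 then 2 else 1)"
    have "k \<in> {1..n}" "?layer k = c"
      using n i b c by (auto simp: k_def)
    then have "(k, c) \<in> page_transversal n i b" "(v, (k, c)) \<in> parcs (book_graph n)"
      using in_T[of k] c by (auto simp: vjc True parcs_book_graph)
    then show ?thesis by blast
  next
    case False
    with j have "(j, ?layer j) \<in> page_transversal n i b" by (intro in_T) simp
    moreover from this have "c \<noteq> ?layer j" using v vjc by blast
    then have "(v, (j, ?layer j)) \<in> parcs (book_graph n)"
      using j b c by (auto simp: vjc parcs_book_graph)
    ultimately show ?thesis by blast
  qed
qed

text \<open>A proper subset still omits the centers but has fewer than \<open>n\<close> elements.\<close>

lemma minimal_dominating_set_page_transversal:
  assumes "n \<ge> 2" "i \<in> {1..n}" "b \<in> {1, 2}"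
  shows "minimal_dominating_set (book_graph n) (page_transversal n i b)"
  unfolding minimal_dominating_set_def
proof (intro conjI allI impI notI)
  show "dominating_set (book_graph n) (page_transversal n i b)"
    by (rule dominating_set_page_transversal[OF assms])
  fix D assume D: "D \<subset> page_transversal n i b" "dominating_set (book_graph n) D"
  then have "\<not> book_centers \<subseteq> D"
    using page_transversal_disjoint_centers[of n i b] by (auto simp: book_centers_def)
  then have "n \<le> card D" by (rule card_dominating_set_missing_center[OF D(2)])
  moreover have "card D < card (page_transversal n i b)"
    using D(1) by (intro psubset_card_mono) (auto simp: page_transversal_def)
  ultimately show False by (simp add: card_page_transversal)
qed

lemma minimal_dominating_set_missing_center:
  assumes "minimal_dominating_set (book_graph n) D" "v \<in> D" "v \<notin> book_centers"
  shows "\<not> book_centers \<subseteq> D"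
  using assms dominating_set_book_centers[of n] unfolding minimal_dominating_set_def by blast

theorem theorem3p18:
  fixes n :: nat and a' :: "nat \<times> nat"
  assumes "n \<ge> 2"
    and "a' \<in> pverts (book_graph n)"
  shows "domination_degree (book_graph n) a' = (if a' \<in> book_centers then 2 else n)"
proof -
  have fin: "finite (pverts (book_graph n))" by (simp add: pverts_book_graph)
  show ?thesis
  proof (cases "a' \<in> book_centers")
    case True
    have card2: "card book_centers = 2" by (simp add: book_centers_def)
    have "domination_degree (book_graph n) a' = card book_centers"
    proof (rule domination_degree_eqI[OF fin _ True])
      show "minimal_dominating_set (book_graph n) book_centers"
        using assms(1) by (intro minimal_dominating_set_book_centers) simp
      show "card book_centers \<le> card D" if "minimal_dominating_set (book_graph n) D" for D
        using that card_dominating_set_ge_2[OF assms(1)]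
        by (simp add: card2 minimal_dominating_set_def)
    qed
    with True card2 show ?thesis by simp
  next
    case False
    obtain i b where ib: "a' = (i, b)" by force
    have i: "i \<in> {1..n}" and b: "b \<in> {1, 2}"
      using assms(2) False by (auto simp: ib pverts_book_graph book_centers_def)
    have "domination_degree (book_graph n) a' = card (page_transversal n i b)"
    proof (rule domination_degree_eqI[OF fin])
      show "minimal_dominating_set (book_graph n) (page_transversal n i b)"
        by (rule minimal_dominating_set_page_transversal[OF assms(1) i b])
      show "a' \<in> page_transversal n i b"
        using i by (auto simp: ib page_transversal_def)
      fix D assume D: "minimal_dominating_set (book_graph n) D" "a' \<in> D"
      then have "\<not> book_centers \<subseteq> D"
        using False by (rule minimal_dominating_set_missing_center)
      with D(1) have "n \<le> card D"
        by (intro card_dominating_set_missing_center) (auto simp: minimal_dominating_set_def)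
      then show "card (page_transversal n i b) \<le> card D" by (simp add: card_page_transversal)
    qed
    with False show ?thesis by (simp add: card_page_transversal)
  qed
qed

end
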